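(* Let $n\in\mathbb N$ and let $g$ be a left-invariant Riemannian metric on $SU(2)$. Suppose that the $j$-fold iterate $$\underbrace{X(X(\cdots X(X}_{j\ \mathrm{times}}(g))\cdots))$$ is (defined and) positive-definite for every $j=1,\ldots,n$. If $$\underbrace{X(X(\cdots X(X}_{n\ \mathrm{times}}(g))\cdots))=g,$$ then $g=\rho g_0$ for some $\rho>0$.
   Context: $g_0$ is the bi-invariant metric on $SU(2)$ with $g_0(A,B)=-2\,\mathrm{tr}(AB)$ for $A,B\in\mathfrak{su}(2)$. For a Riemannian metric $g$, let $\mathrm{Ric}(g)$ and $S(g)$ denote the Ricci and scalar curvature, and let $\mathcal E(g)$ be the field of endomorphisms with $g(\mathcal E(g)u,v)=\mathrm{Ric}(g)(u,v)-\tfrac12S(g)g(u,v)$. When $\mathcal E(g)$ is invertible, the cross curvature $(0,2)$-tensor is $X(g)(u,v)=\det(\mathcal E(g))\,g(\mathcal E(g)^{-1}u,v)$. If $X(g)$ is positive-definite, it is itself viewed as a Riemannian metric, to which $X$ can be applied again. Here $n\ge1$. *)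

theory Defs
  imports "HOL-Analysis.Analysis"
begin

section \<open>The group SU(2) as a submanifold of the complex 2x2 matrices\<close>

type_synonym cmat = "complex^2^2"

definition cadj :: "cmat \<Rightarrow> cmat" where
  "cadj A = (\<chi> i j. cnj (A $ j $ i))"

definition SU2 :: "cmat set" where
  "SU2 = {x. cadj x ** x = mat 1 \<and> det x = 1}"

definition su2 :: "cmat set" where
  "su2 = {A. cadj A = - A \<and> trace A = 0}"

definition tangent :: "cmat \<Rightarrow> cmat set" where
  "tangent x = (\<lambda>A. x ** A) ` su2"

text \<open>Left-invariant extension of a vector tangent at \<open>x\<close>; note \<open>x\<^sup>-\<^sup>1 = cadj x\<close> on SU(2).\<close>

definition left_ext :: "cmat \<Rightarrow> cmat \<Rightarrow> (cmat \<Rightarrow> cmat)" where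
  "left_ext x u = (\<lambda>y. y ** (cadj x ** u))"

text \<open>Derivative of \<open>f\<close> at \<open>x\<close> in the direction of a tangent vector \<open>v\<close>. The Frechet derivative
  within SU(2) is not unique as a linear map on all of \<open>cmat\<close>, but its values on \<open>tangent x\<close> are;
  it is only ever evaluated there.\<close>

definition dd :: "(cmat \<Rightarrow> 'b::real_normed_vector) \<Rightarrow> cmat \<Rightarrow> cmat \<Rightarrow> 'b" where
  "dd f x v = frechet_derivative f (at x within SU2) v"

text \<open>Class \<open>C\<^sup>k\<close> on SU(2); the left-invariant fields \<open>x \<mapsto> x ** A\<close> span every tangent space.\<close>

primrec Ck :: "nat \<Rightarrow> (cmat \<Rightarrow> real) \<Rightarrow> bool" where
  "Ck 0 f \<longleftrightarrow> continuous_on SU2 f"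
| "Ck (Suc k) f \<longleftrightarrow> f differentiable_on SU2 \<and> (\<forall>A\<in>su2. Ck k (\<lambda>x. dd f x (x ** A)))"

section \<open>Covariant 2-tensors and Riemannian metrics\<close>

text \<open>A (0,2)-tensor field \<open>h\<close> on SU(2) assigns to \<open>x \<in> SU2\<close> and \<open>u, v \<in> tangent x\<close> the number
  \<open>h x u v\<close>; values at other arguments carry no meaning, so tensor fields are compared by
  \<open>tensor_eq\<close> and not by HOL equality.\<close>

type_synonym tensor2 = "cmat \<Rightarrow> cmat \<Rightarrow> cmat \<Rightarrow> real"

definition tensor_eq :: "tensor2 \<Rightarrow> tensor2 \<Rightarrow> bool" where
  "tensor_eq h k \<longleftrightarrow> (\<forall>x\<in>SU2. \<forall>u\<in>tangent x. \<forall>v\<in>tangent x. h x u v = k x u v)"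

definition positive_definite :: "tensor2 \<Rightarrow> bool" where
  "positive_definite h \<longleftrightarrow> (\<forall>x\<in>SU2. \<forall>u\<in>tangent x. u \<noteq> 0 \<longrightarrow> h x u u > 0)"

definition riemannian_metric :: "tensor2 \<Rightarrow> bool" where
  "riemannian_metric g \<longleftrightarrow>
     (\<forall>x\<in>SU2. \<forall>u\<in>tangent x. \<forall>v\<in>tangent x. \<forall>w\<in>tangent x. \<forall>a b.
        g x (a *\<^sub>R u + b *\<^sub>R v) w = a * g x u w + b * g x v w) \<and>
     (\<forall>x\<in>SU2. \<forall>u\<in>tangent x. \<forall>v\<in>tangent x. g x u v = g x v u) \<and>
     positive_definite g \<and>
     (\<forall>A\<in>su2. \<forall>B\<in>su2. \<forall>k. Ck k (\<lambda>x. g x (x ** A) (x ** B)))"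

definition left_invariant :: "tensor2 \<Rightarrow> bool" where
  "left_invariant h \<longleftrightarrow>
     (\<forall>a\<in>SU2. \<forall>x\<in>SU2. \<forall>u\<in>tangent x. \<forall>v\<in>tangent x. h (a ** x) (a ** u) (a ** v) = h x u v)"

text \<open>The trace below is real; \<open>Re\<close> only adjusts the type.\<close>

definition g0 :: tensor2 where
  "g0 x u v = - 2 * Re (trace ((cadj x ** u) ** (cadj x ** v)))"

section \<open>Endomorphisms of tangent spaces\<close>

text \<open>The basis \<open>(\<i>/2) \<sigma>\<^sub>k\<close> of su(2), with \<open>\<sigma>\<^sub>k\<close> the Pauli matrices. It serves only to represent
  endomorphisms of a tangent space by real 3x3 matrices; trace and determinant do not depend on
  the choice.\<close>

definition su2_basis :: "3 \<Rightarrow> cmat" where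
  "su2_basis k =
     (if k = 1 then vector [vector [0, \<i> / 2], vector [\<i> / 2, 0]]
      else if k = 2 then vector [vector [0, 1 / 2], vector [- 1 / 2, 0]]
      else vector [vector [\<i> / 2, 0], vector [0, - \<i> / 2]])"

definition coords :: "cmat \<Rightarrow> cmat \<Rightarrow> real^3" where
  "coords x v = (THE c. v = (\<Sum>k\<in>UNIV. (c $ k) *\<^sub>R (x ** su2_basis k)))"

definition endo_matrix :: "cmat \<Rightarrow> (cmat \<Rightarrow> cmat) \<Rightarrow> real^3^3" where
  "endo_matrix x L = (\<chi> i j. coords x (L (x ** su2_basis j)) $ i)"

text \<open>The endomorphism \<open>L\<close> of \<open>tangent x\<close> with \<open>g x (L u) v = b u v\<close>.\<close>

definition raise :: "tensor2 \<Rightarrow> cmat \<Rightarrow> (cmat \<Rightarrow> cmat \<Rightarrow> real) \<Rightarrow> cmat \<Rightarrow> cmat" where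
  "raise g x b u = (THE w. w \<in> tangent x \<and> (\<forall>v\<in>tangent x. g x w v = b u v))"

section \<open>Levi-Civita connection and curvature\<close>

text \<open>Vector fields are maps \<open>V\<close> with \<open>V x \<in> tangent x\<close> for \<open>x \<in> SU2\<close>.\<close>

definition bracket :: "(cmat \<Rightarrow> cmat) \<Rightarrow> (cmat \<Rightarrow> cmat) \<Rightarrow> cmat \<Rightarrow> cmat" where
  "bracket V W x = dd W x (V x) - dd V x (W x)"

definition koszul ::
  "tensor2 \<Rightarrow> (cmat \<Rightarrow> cmat) \<Rightarrow> (cmat \<Rightarrow> cmat) \<Rightarrow> (cmat \<Rightarrow> cmat) \<Rightarrow> cmat \<Rightarrow> real" where
  "koszul g V W Z x =
     dd (\<lambda>y. g y (W y) (Z y)) x (V x)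
     + dd (\<lambda>y. g y (Z y) (V y)) x (W x)
     - dd (\<lambda>y. g y (V y) (W y)) x (Z x)
     + g x (bracket V W x) (Z x)
     - g x (bracket W Z x) (V x)
     + g x (bracket Z V x) (W x)"

text \<open>Koszul's formula is tensorial in \<open>Z\<close>, so testing it on the left-invariant fields determines
  the covariant derivative.\<close>

definition nabla :: "tensor2 \<Rightarrow> (cmat \<Rightarrow> cmat) \<Rightarrow> (cmat \<Rightarrow> cmat) \<Rightarrow> cmat \<Rightarrow> cmat" where
  "nabla g V W x =
     (THE w. w \<in> tangent x \<and>
        (\<forall>z\<in>tangent x. 2 * g x w z = koszul g V W (left_ext x z) x))"

definition riem ::
  "tensor2 \<Rightarrow> (cmat \<Rightarrow> cmat) \<Rightarrow> (cmat \<Rightarrow> cmat) \<Rightarrow> (cmat \<Rightarrow> cmat) \<Rightarrow> cmat \<Rightarrow> cmat" where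
  "riem g U V W x =
     nabla g U (nabla g V W) x - nabla g V (nabla g U W) x - nabla g (bracket U V) W x"

text \<open>\<open>Ric (u, v)\<close> is the trace of \<open>w \<mapsto> R(w, u) v\<close>. The curvature is tensorial, so its value at
  tangent vectors may be computed with any extensions to vector fields.\<close>

definition Ric :: "tensor2 \<Rightarrow> tensor2" where
  "Ric g x u v =
     trace (endo_matrix x (\<lambda>w. riem g (left_ext x w) (left_ext x u) (left_ext x v) x))"

definition scal :: "tensor2 \<Rightarrow> cmat \<Rightarrow> real" where
  "scal g x = trace (endo_matrix x (raise g x (Ric g x)))"

section \<open>Cross curvature\<close>

definition einstein_endo :: "tensor2 \<Rightarrow> cmat \<Rightarrow> cmat \<Rightarrow> cmat" where
  "einstein_endo g x = raise g x (\<lambda>u v. Ric g x u v - 1 / 2 * scal g x * g x u v)"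

definition cross_defined :: "tensor2 \<Rightarrow> bool" where
  "cross_defined g \<longleftrightarrow> (\<forall>x\<in>SU2. bij_betw (einstein_endo g x) (tangent x) (tangent x))"

text \<open>Meaningful only if \<open>g\<close> is a metric with \<open>cross_defined g\<close>.\<close>

definition cross_curv :: "tensor2 \<Rightarrow> tensor2" where
  "cross_curv g x u v =
     det (endo_matrix x (einstein_endo g x))
       * g x (inv_into (tangent x) (einstein_endo g x) u) v"

end

theory Submission
  imports Defs
begin

text \<open>
  Cross curvature stretches every left-invariant metric that is not round, so no such metric can
  return to itself.

  The Lie algebra su(2) with the inner product \<open>g0\<close> is Euclidean 3-space with the bracket
  \<open>[a, b] = - a \<times> b\<close>. Rotations preserve the cross product, so one may rotate the basis until a given
  left-invariant metric has a diagonal matrix \<open>diag(x, y, z)\<close>, without changing the structure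
  constants (\<open>left_invariant_metric_diagonal\<close>). In such a frame Koszul's formula, the curvature
  tensor, the Ricci tensor and the Einstein endomorphism are explicit, and everything is diagonal
  again. If \<open>K\<^sub>1, K\<^sub>2, K\<^sub>3\<close> are the sectional curvatures of the planes orthogonal to the axes, the
  Einstein endomorphism is \<open>- diag(K\<^sub>1, K\<^sub>2, K\<^sub>3)\<close>, and cross curvature acts in the fixed frame as
  the map \<open>(x, y, z) \<mapsto> (x K\<^sub>2 K\<^sub>3, y K\<^sub>3 K\<^sub>1, z K\<^sub>1 K\<^sub>2)\<close> (\<open>diagonal_metric_cross_curv\<close>).

  It remains to see that this map has no periodic points except multiples of \<open>(1, 1, 1)\<close>. If its
  image is positive, the three curvatures have the same sign; the plane orthogonal to the shortest
  axis always has positive curvature, so all three are positive (\<open>sect_vec_pos\<close>). Positive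
  curvature forces the strict triangle inequalities between \<open>x, y, z\<close>, and
  \<open>K\<^sub>2 - K\<^sub>1 = (x - y) (x + y - z) / (x y z)\<close>. Hence \<open>x > y\<close> gives \<open>K\<^sub>2 > K\<^sub>1 > 0\<close>, and the ratio
  \<open>x / y\<close> is multiplied by \<open>K\<^sub>2 / K\<^sub>1 > 1\<close> (\<open>cross_step_ratio\<close>). A ratio different from 1 therefore
  moves strictly away from 1 at every step and never recurs.
\<close>

section \<open>Matrix algebra of SU(2) and su(2)\<close>

lemma cadj_mul: "cadj (A ** B) = cadj B ** cadj A"
  by (simp add: cadj_def matrix_matrix_mult_def vec_eq_iff mult.commute)

lemma SU2_adj_left: "x \<in> SU2 \<Longrightarrow> cadj x ** x = mat 1"
  by (simp add: SU2_def)

lemma SU2_cancel: "x \<in> SU2 \<Longrightarrow> cadj x ** (x ** A) = A"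
  by (simp add: SU2_adj_left matrix_mul_assoc)

lemma one_in_SU2: "mat 1 \<in> SU2"
  by (simp add: SU2_def cadj_def vec_eq_iff forall_2 matrix_matrix_mult_def mat_def UNIV_2 det_2)

lemma SU2_mul: "x \<in> SU2 \<Longrightarrow> y \<in> SU2 \<Longrightarrow> x ** y \<in> SU2"
  unfolding SU2_def by (simp add: cadj_mul det_mul) (metis matrix_mul_assoc matrix_mul_lid)

lemma mat_mul_scaleR_right: "x ** (c *\<^sub>R A) = c *\<^sub>R (x ** A)" for x A :: cmat
  by (simp add: matrix_matrix_mult_def vec_eq_iff scaleR_sum_right)

lemma mat_mul_scaleR_left: "(c *\<^sub>R x) ** A = c *\<^sub>R (x ** A)" for x A :: cmat
  by (simp add: matrix_matrix_mult_def vec_eq_iff scaleR_sum_right)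

lemma linear_mul_left: "linear (\<lambda>A :: cmat. x ** A)" for x :: cmat
  by (simp add: linear_iff matrix_add_ldistrib mat_mul_scaleR_right)

lemma linear_mul_right: "linear (\<lambda>x :: cmat. x ** A)" for A :: cmat
  by (simp add: linear_iff matrix_matrix_mult_def vec_eq_iff scaleR_sum_right distrib_right sum.distrib)

definition su2_of :: "real^3 \<Rightarrow> cmat" where
  "su2_of c = (\<Sum>k\<in>UNIV. (c $ k) *\<^sub>R su2_basis k)"

lemma su2_of_entries:
  "su2_of c $ 1 $ 1 = Complex 0 (c $ 3 / 2)"
  "su2_of c $ 1 $ 2 = Complex (c $ 2 / 2) (c $ 1 / 2)"
  "su2_of c $ 2 $ 1 = Complex (- c $ 2 / 2) (c $ 1 / 2)"
  "su2_of c $ 2 $ 2 = Complex 0 (- c $ 3 / 2)"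
  by (simp_all add: su2_of_def sum_3 su2_basis_def complex_eq_iff)

lemma linear_su2_of: "linear su2_of"
  by (simp add: linear_iff vec_eq_iff forall_2 su2_of_entries complex_eq_iff add_divide_distrib)

lemma su2_eq_range: "su2 = range su2_of"
proof -
  have "A \<in> range su2_of" if "A \<in> su2" for A
  proof -
    have *: "cnj (A$1$1) = - A$1$1" "cnj (A$2$1) = - A$1$2" "A$1$1 + A$2$2 = 0"
      using that by (simp_all add: su2_def cadj_def vec_eq_iff forall_2 trace_def UNIV_2)
    have "A$1$1 = Complex 0 (Im (A$1$1))" "A$2$1 = - cnj (A$1$2)" "A$2$2 = Complex 0 (- Im (A$1$1))"
      using *(1) arg_cong[OF *(2), of cnj] *(3) by (auto simp: complex_eq_iff)
    then have "A = su2_of (vector [2 * Im (A$1$2), 2 * Re (A$1$2), 2 * Im (A$1$1)])"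
      unfolding vec_eq_iff forall_2 su2_of_entries vector_3 by (simp add: complex_eq_iff)
    then show ?thesis by blast
  qed
  moreover have "su2_of c \<in> su2" for c
    by (simp add: su2_def cadj_def vec_eq_iff forall_2 trace_def UNIV_2 su2_of_entries complex_eq_iff)
  ultimately show ?thesis by blast
qed

text \<open>The Lie algebra is Euclidean 3-space with the negative cross product; this is what lets
  rotations of 3-space act as changes of frame below.\<close>

lemma su2_of_commutator:
  "su2_of a ** su2_of b - su2_of b ** su2_of a = - su2_of (cross3 a b)"
  by (simp add: vec_eq_iff forall_2 matrix_matrix_mult_def UNIV_2 su2_of_entries complex_eq_iff
      cross3_def field_simps)

lemma trace_su2_of: "trace (su2_of a ** su2_of b) = of_real (- (a \<bullet> b) / 2)"
  by (simp add: trace_def matrix_matrix_mult_def UNIV_2 su2_of_entries complex_eq_iff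
      inner_vec_def sum_3 field_simps)

lemma inj_su2_of: "su2_of a = su2_of b \<Longrightarrow> a = b"
  by (simp add: vec_eq_iff forall_2 forall_3 su2_of_entries)

text \<open>The unit quaternions; they provide the curves in SU(2) along which derivatives are taken.\<close>

lemma quaternion_in_SU2:
  assumes "p\<^sup>2 + (norm a)\<^sup>2 / 4 = 1"
  shows "p *\<^sub>R mat 1 + su2_of a \<in> SU2"
proof -
  have "p\<^sup>2 + ((a$1)\<^sup>2 + (a$2)\<^sup>2 + (a$3)\<^sup>2) / 4 = 1"
    using assms by (simp add: power2_norm_eq_inner[of a] inner_vec_def sum_3 flip: power2_eq_square)
  then show ?thesis
    by (simp add: SU2_def cadj_def vec_eq_iff forall_2 matrix_matrix_mult_def mat_def UNIV_2 det_2
        su2_of_entries complex_eq_iff) (simp add: field_simps power2_eq_square)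
qed

section \<open>Derivatives along SU(2)\<close>

text \<open>SU(2) has empty interior in the space of matrices, so a derivative within it is determined only
  in tangent directions. There it is, because a left translate of a one-parameter subgroup is a curve
  inside SU(2) with velocity \<open>v\<close>, and derivatives of functions of one variable are unique.\<close>

lemma SU2_derivative_unique:
  fixes f :: "cmat \<Rightarrow> 'b::real_normed_vector"
  assumes x: "x \<in> SU2" and v: "v \<in> tangent x"
    and f': "(f has_derivative f') (at x within SU2)"
    and f'': "(f has_derivative f'') (at x within SU2)"
  shows "f' v = f'' v"
proof -
  obtain a where a: "v = x ** su2_of a"
    using v by (auto simp: tangent_def su2_eq_range)
  show ?thesis
  proof (cases "a = 0")
    case True
    then have "v = 0"
      by (simp add: a linear_0[OF linear_su2_of] linear_0[OF linear_mul_left])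
    then show ?thesis
      using f' f'' by (simp add: has_derivative_def bounded_linear.linear linear_0)
  next
    case False
    define r where "r = norm a / 2"
    have r: "r \<noteq> 0" using False by (simp add: r_def)
    \<comment> \<open>The curve \<open>x exp(t A)\<close>: as \<open>A = su2_of a\<close> has square \<open>- r\<^sup>2\<close>, its exponential is trigonometric.\<close>
    define \<gamma> where "\<gamma> t = x ** (cos (r * t) *\<^sub>R mat 1 + (sin (r * t) / r) *\<^sub>R su2_of a)" for t
    have "cos (r * t) *\<^sub>R mat 1 + su2_of ((sin (r * t) / r) *\<^sub>R a) \<in> SU2" for t
      by (rule quaternion_in_SU2) (use False in \<open>simp add: r_def power_mult_distrib power_divide\<close>)
    then have img: "\<gamma> ` UNIV \<subseteq> SU2"
      by (auto simp: \<gamma>_def linear_cmul[OF linear_su2_of] intro!: SU2_mul[OF x])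
    have 0: "\<gamma> 0 = x" by (simp add: \<gamma>_def)
    have bl: "bounded_linear (\<lambda>A :: cmat. x ** A)"
      by (rule linear_conv_bounded_linear[THEN iffD1, OF linear_mul_left])
    have "((\<lambda>t. cos (r * t) *\<^sub>R mat 1 + (sin (r * t) / r) *\<^sub>R su2_of a)
            has_derivative (\<lambda>t. t *\<^sub>R su2_of a)) (at 0)"
      using r by (auto intro!: derivative_eq_intros)
    from bounded_linear.has_derivative[OF bl this]
    have g: "(\<gamma> has_derivative (\<lambda>t. t *\<^sub>R v)) (at 0)"
      by (simp add: \<gamma>_def[abs_def] a mat_mul_scaleR_right)
    have "(f \<circ> \<gamma> has_derivative F \<circ> (\<lambda>t. t *\<^sub>R v)) (at 0)"
      if "(f has_derivative F) (at x within SU2)" for F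
      by (rule diff_chain_within[OF g])
        (use that img 0 has_derivative_subset in auto)
    from has_derivative_unique[OF this[OF f'] this[OF f'']]
    have "(f' \<circ> (\<lambda>t. t *\<^sub>R v)) 1 = (f'' \<circ> (\<lambda>t. t *\<^sub>R v)) 1" by simp
    then show ?thesis by simp
  qed
qed

lemma dd_eq:
  assumes "x \<in> SU2" "v \<in> tangent x" "(f has_derivative f') (at x within SU2)"
  shows "dd f x v = f' v"
  unfolding dd_def
  by (rule SU2_derivative_unique[OF assms(1,2) _ assms(3)])
    (use assms(3) differentiableI frechet_derivative_works in blast)

text \<open>With left-invariant fields as arguments, a left-invariant metric takes constant values, so this
  removes the three derivative terms of Koszul's formula.\<close>

lemma dd_const:
  assumes "x \<in> SU2" "v \<in> tangent x" "\<And>y. y \<in> SU2 \<Longrightarrow> f y = c"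
  shows "dd f x v = 0"
  by (rule dd_eq[OF assms(1,2)], rule has_derivative_transform[OF assms(1,3) has_derivative_const])

lemma dd_left_field:
  fixes A :: cmat
  assumes "x \<in> SU2" "v \<in> tangent x" "\<And>y. y \<in> SU2 \<Longrightarrow> V y = y ** A"
  shows "dd V x v = v ** A"
  by (rule dd_eq[OF assms(1,2)], rule has_derivative_transform[OF assms(1,3)], assumption)
    (rule bounded_linear_imp_has_derivative
      [OF linear_conv_bounded_linear[THEN iffD1, OF linear_mul_right]])

lemma bracket_left_fields:
  assumes x: "x \<in> SU2"
    and V: "\<And>y. y \<in> SU2 \<Longrightarrow> V y = y ** su2_of a"
    and W: "\<And>y. y \<in> SU2 \<Longrightarrow> W y = y ** su2_of b"
  shows "bracket V W x = x ** su2_of (- (cross3 a b))"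
proof -
  have "x ** su2_of a \<in> tangent x" "x ** su2_of b \<in> tangent x"
    by (auto simp: tangent_def su2_eq_range)
  then have "bracket V W x = x ** (su2_of a ** su2_of b - su2_of b ** su2_of a)"
    by (simp add: bracket_def V[OF x] W[OF x] dd_left_field[OF x _ V] dd_left_field[OF x _ W]
        matrix_mul_assoc linear_diff[OF linear_mul_left])
  then show ?thesis
    by (simp add: su2_of_commutator linear_neg[OF linear_su2_of])
qed

section \<open>Curvature in a diagonalising frame\<close>

text \<open>The tangent vector with coordinates \<open>a\<close> in the left-invariant frame whose members are the columns
  of \<open>Q\<close>, read as elements of su(2).\<close>

definition frame :: "real^3^3 \<Rightarrow> cmat \<Rightarrow> real^3 \<Rightarrow> cmat" where
  "frame Q x a = x ** su2_of (Q *v a)"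

lemma linear_frame: "linear (frame Q x)"
proof -
  have "frame Q x = (\<lambda>A. x ** A) \<circ> su2_of \<circ> (\<lambda>a. Q *v a)"
    by (auto simp: frame_def)
  then show ?thesis
    by (simp add: linear_compose linear_mul_left linear_su2_of)
qed

lemma coords_su2_of:
  assumes "x \<in> SU2"
  shows "coords x (x ** su2_of c) = c"
proof -
  have "(\<Sum>k\<in>UNIV. (c' $ k) *\<^sub>R (x ** su2_basis k)) = x ** su2_of c'" for c'
    by (simp add: su2_of_def linear_sum[OF linear_mul_left] mat_mul_scaleR_right)
  moreover have "x ** su2_of c = x ** su2_of c' \<Longrightarrow> c = c'" for c'
    by (metis SU2_cancel assms inj_su2_of)
  ultimately show ?thesis
    unfolding coords_def by (metis (mono_tags, lifting) the_equality)
qed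

lemma su2_basis_eq: "su2_basis k = su2_of (axis k 1)"
  by (simp add: su2_of_def axis_def if_distrib[of "\<lambda>c. c *\<^sub>R _"] cong: if_cong)

lemma endo_matrix_frame:
  assumes Q: "orthogonal_matrix Q" and x: "x \<in> SU2"
    and L: "\<And>a. L (frame Q x a) = frame Q x (M *v a)"
  shows "endo_matrix x L = Q ** M ** transpose Q"
proof -
  have "x ** su2_basis j = frame Q x (transpose Q *v axis j 1)" for j
    using Q by (simp add: frame_def su2_basis_eq matrix_vector_mul_assoc orthogonal_matrix_def
        del: transpose_matrix_vector)
  then have "coords x (L (x ** su2_basis j)) = (Q ** M ** transpose Q) *v axis j 1" for j
    by (simp add: L del: transpose_matrix_vector)
      (simp add: frame_def coords_su2_of[OF x] matrix_vector_mul_assoc matrix_mul_assoc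
        del: transpose_matrix_vector)
  then show ?thesis
    by (simp add: endo_matrix_def vec_eq_iff matrix_vector_mul_component inner_axis)
qed

text \<open>Passing from the standard basis to the frame conjugates the matrix by \<open>Q\<close>, which affects neither
  trace nor determinant.\<close>

lemma endo_matrix_invariants:
  assumes Q: "orthogonal_matrix Q" and x: "x \<in> SU2"
    and L: "\<And>a. L (frame Q x a) = frame Q x (M *v a)"
  shows "trace (endo_matrix x L) = trace M" "det (endo_matrix x L) = det M"
proof -
  have E: "endo_matrix x L = Q ** (M ** transpose Q)"
    by (simp add: endo_matrix_frame[OF assms] matrix_mul_assoc)
  have QQ: "transpose Q ** Q = mat 1"
    using Q by (simp add: orthogonal_matrix_def)
  have "trace (endo_matrix x L) = trace (M ** transpose Q ** Q)"
    unfolding E by (rule trace_mul_sym)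
  then show "trace (endo_matrix x L) = trace M"
    by (simp add: QQ flip: matrix_mul_assoc)
  have "det (transpose Q) * det Q = 1"
    using arg_cong[OF QQ, of det] by (simp add: det_mul)
  then show "det (endo_matrix x L) = det M"
    by (simp add: E det_mul)
qed

definition diag_mat :: "real^3 \<Rightarrow> real^3^3" where
  "diag_mat e = (\<chi> i j. if i = j then e $ i else 0)"

lemma diag_mat_mult: "diag_mat e *v a = e * a"
  by (simp add: diag_mat_def matrix_vector_mult_def vec_eq_iff forall_3 sum_3)

lemma trace_diag_mat: "trace (diag_mat e) = e$1 + e$2 + e$3"
  by (simp add: trace_def diag_mat_def sum_3)

lemma det_diag_mat: "det (diag_mat e) = e$1 * e$2 * e$3"
  by (simp add: det_3 diag_mat_def)

definition vdiv :: "real^3 \<Rightarrow> real^3 \<Rightarrow> real^3" where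
  "vdiv a b = (\<chi> k. a $ k / b $ k)"

lemma vdiv_component: "vdiv a b $ k = a $ k / b $ k"
  by (simp add: vdiv_def)

text \<open>The Levi-Civita connection of the metric \<open>diag(d)\<close> on left-invariant fields: Koszul's formula
  with bracket \<open>- a \<times> b\<close>, solved for the covariant derivative.\<close>

definition connection :: "real^3 \<Rightarrow> real^3 \<Rightarrow> real^3 \<Rightarrow> real^3" where
  "connection d a b = vdiv (cross3 (d * a) b - cross3 a (d * b) - d * cross3 a b) (2 *\<^sub>R d)"

text \<open>The last term of the curvature tensor enters with a plus because the bracket of \<open>a\<close> and \<open>b\<close> is
  \<open>- a \<times> b\<close>.\<close>

definition curvature :: "real^3 \<Rightarrow> real^3 \<Rightarrow> real^3 \<Rightarrow> real^3 \<Rightarrow> real^3" where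
  "curvature d a b c = connection d a (connection d b c) - connection d b (connection d a c)
    + connection d (cross3 a b) c"

text \<open>Milnor's formula: the diagonal of the Ricci tensor, as a bilinear form, in the frame.\<close>

definition ricci_diag :: "real^3 \<Rightarrow> real^3" where
  "ricci_diag d = vector [((d$1)\<^sup>2 - (d$2 - d$3)\<^sup>2) / (2 * d$2 * d$3),
                    ((d$2)\<^sup>2 - (d$3 - d$1)\<^sup>2) / (2 * d$3 * d$1),
                    ((d$3)\<^sup>2 - (d$1 - d$2)\<^sup>2) / (2 * d$1 * d$2)]"

text \<open>The sectional curvature of the plane orthogonal to the axis of squared length \<open>x\<close>, for the metric
  \<open>diag(x, y, z)\<close>.\<close>

definition sect :: "real \<Rightarrow> real \<Rightarrow> real \<Rightarrow> real" where
  "sect x y z = ((y - z)\<^sup>2 + 2 * x * (y + z) - 3 * x\<^sup>2) / (4 * x * y * z)"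

definition sect_vec :: "real^3 \<Rightarrow> real^3" where
  "sect_vec d = vector [sect (d$1) (d$2) (d$3), sect (d$2) (d$3) (d$1), sect (d$3) (d$1) (d$2)]"

text \<open>The action of cross curvature on diagonal metrics. The determinant of the Einstein endomorphism
  times its inverse has on each axis the product of the other two eigenvalues, whose minus signs
  cancel.\<close>

definition cross_step :: "real^3 \<Rightarrow> real^3" where
  "cross_step d = vector [d$1 * sect_vec d $ 2 * sect_vec d $ 3,
                      d$2 * sect_vec d $ 3 * sect_vec d $ 1,
                      d$3 * sect_vec d $ 1 * sect_vec d $ 2]"

lemma linear_connection: "linear (connection d a)" "linear (\<lambda>a. connection d a b)"
  by (simp_all add: linear_iff connection_def vdiv_def cross3_simps add_divide_distrib diff_divide_distrib)

lemma linear_curvature: "linear (\<lambda>a. curvature d a b c)"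
  unfolding curvature_def
  by (simp add: linear_iff linear_add[OF linear_connection(1)] linear_add[OF linear_connection(2)]
      linear_cmul[OF linear_connection(1)] linear_cmul[OF linear_connection(2)] cross_add_left cross_mult_left
      scaleR_diff_right scaleR_add_right)

lemma tangent_eq_range_frame:
  assumes Q: "orthogonal_matrix Q"
  shows "tangent x = range (frame Q x)"
proof -
  have "x ** su2_of c = frame Q x (transpose Q *v c)" for c
    using Q by (simp add: frame_def matrix_vector_mul_assoc orthogonal_matrix_def
        del: transpose_matrix_vector)
  then show ?thesis
    by (fastforce simp: tangent_def su2_eq_range frame_def)
qed

text \<open>Left-invariant fields kill the derivative terms of Koszul's formula; the right-hand side is what
  is left.\<close>

lemma connection_koszul:
  assumes "\<And>k. d $ k > 0"
  shows "2 * ((d * connection d a b) \<bullet> c)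
    = (d * (- cross3 a b)) \<bullet> c - (d * (- cross3 b c)) \<bullet> a + (d * (- cross3 c a)) \<bullet> b"
proof -
  have "d$1 \<noteq> 0" "d$2 \<noteq> 0" "d$3 \<noteq> 0"
    using assms by (metis less_irrefl)+
  then have "2 *\<^sub>R (d * connection d a b) = cross3 (d * a) b - cross3 a (d * b) - d * cross3 a b"
    by (simp add: connection_def vdiv_def vec_eq_iff forall_3)
  from arg_cong[OF this, of "\<lambda>v. v \<bullet> c"] show ?thesis
    by (simp add: cross3_simps)
qed

text \<open>Reduces the trace that defines the Ricci tensor to a rational identity in the three metric
  coefficients.\<close>

lemma ricci_trace:
  assumes "\<And>k. d $ k > 0"
  shows "curvature d (axis 1 1) a b $ 1 + curvature d (axis 2 1) a b $ 2 + curvature d (axis 3 1) a b $ 3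
    = (ricci_diag d * a) \<bullet> b"
proof -
  obtain x y z where d: "x = d$1" "y = d$2" "z = d$3" by blast
  have "x \<noteq> 0" "y \<noteq> 0" "z \<noteq> 0"
    using assms unfolding d by (metis less_irrefl)+
  then show ?thesis
    by (simp add: curvature_def connection_def vdiv_component cross3_def axis_def ricci_diag_def inner_vec_def sum_3
        d[symmetric]) (simp add: divide_simps, algebra)
qed

text \<open>In dimension 3 the Ricci tensor determines the curvature tensor: the eigenvalues of the Einstein
  endomorphism are the negatives of the sectional curvatures of the orthogonal planes.\<close>

lemma einstein_eq_minus_sect:
  assumes "\<And>k. d $ k > 0"
  shows "ricci_diag d $ k / d $ k
      - (ricci_diag d $ 1 / d $ 1 + ricci_diag d $ 2 / d $ 2 + ricci_diag d $ 3 / d $ 3) / 2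
    = - sect_vec d $ k"
proof -
  obtain x y z where d: "x = d$1" "y = d$2" "z = d$3" by blast
  have "x \<noteq> 0" "y \<noteq> 0" "z \<noteq> 0"
    using assms unfolding d by (metis less_irrefl)+
  note nz = this
  consider "k = 1" | "k = 2" | "k = 3"
    using exhaust_3 by blast
  then show ?thesis
    using nz by cases (simp_all add: ricci_diag_def sect_vec_def sect_def d[symmetric],
        simp_all add: divide_simps, simp_all add: power2_eq_square algebra_simps)
qed

text \<open>A left-invariant metric that is diagonal in the frame of a rotation \<open>Q\<close>. Symmetry, bilinearity and
  left-invariance are all contained in the formula for \<open>h\<close>. Requiring a rotation and not merely an
  orthogonal matrix keeps the structure constants those of the cross product.\<close>

locale diagonal_metric =
  fixes Q :: "real^3^3" and d :: "real^3" and h :: tensor2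
  assumes rotation: "rotation_matrix Q"
    and pos: "\<And>k. d $ k > 0"
    and diag: "\<And>x a b. x \<in> SU2 \<Longrightarrow> h x (frame Q x a) (frame Q x b) = (d * a) \<bullet> b"
begin

lemma orth: "orthogonal_matrix Q"
  using rotation by (simp add: rotation_matrix_def)

lemmas tangent_frame = tangent_eq_range_frame[OF orth]

lemma frame_inj: "x \<in> SU2 \<Longrightarrow> frame Q x a = frame Q x b \<longleftrightarrow> a = b"
proof
  assume x: "x \<in> SU2" and e: "frame Q x a = frame Q x b"
  have "Q *v a = Q *v b"
    using x e unfolding frame_def by (metis SU2_cancel inj_su2_of)
  then have "transpose Q *v (Q *v a) = transpose Q *v (Q *v b)" by simp
  then show "a = b"
    using orth by (simp add: matrix_vector_mul_assoc orthogonal_matrix_def del: transpose_matrix_vector)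
qed simp

lemma diag_nondegenerate:
  assumes "\<And>c. (d * a) \<bullet> c = b \<bullet> c"
  shows "a = vdiv b d"
proof -
  have "d * a = b"
    using assms by (metis vector_eq_ldot inner_commute)
  then have "\<And>k. d $ k * a $ k = b $ k" by (metis vector_mult_component)
  then show ?thesis
    using pos by (simp add: vec_eq_iff vdiv_component field_simps) (metis less_irrefl mult.commute nonzero_eq_divide_eq)
qed

text \<open>The definitions of the connection and of raising an index both choose the vector dual to a linear
  form; non-degeneracy makes the choice unique. The factor \<open>m\<close> is 2 in Koszul's formula and 1
  otherwise.\<close>

lemma the_metric_dual:
  assumes "x \<in> SU2" "\<And>c. f (frame Q x c) = m * ((d * w) \<bullet> c)" "m \<noteq> 0"
  shows "(THE v. v \<in> tangent x \<and> (\<forall>z\<in>tangent x. m * h x v z = f z)) = frame Q x w"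
proof (rule the_equality)
  show "frame Q x w \<in> tangent x \<and> (\<forall>z\<in>tangent x. m * h x (frame Q x w) z = f z)"
    using assms by (auto simp: tangent_frame diag)
next
  fix v assume v: "v \<in> tangent x \<and> (\<forall>z\<in>tangent x. m * h x v z = f z)"
  then obtain a where a: "v = frame Q x a" by (auto simp: tangent_frame)
  have "(d * a) \<bullet> c = (d * w) \<bullet> c" for c
    using v assms by (auto simp: tangent_frame diag a)
  then have "a = vdiv (d * w) d" by (rule diag_nondegenerate)
  then have "a = w"
    using pos by (simp add: vec_eq_iff vdiv_component) (metis less_irrefl)
  then show "v = frame Q x w" by (simp add: a)
qed

lemma raise_diag:
  assumes "x \<in> SU2" "\<And>c. b (frame Q x a) (frame Q x c) = (r * a) \<bullet> c"
  shows "raise h x b (frame Q x a) = frame Q x (vdiv r d * a)"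
proof -
  have "d * (vdiv r d * a) = r * a"
    using pos by (simp add: vec_eq_iff vdiv_component) (metis less_irrefl)
  then show ?thesis
    using the_metric_dual[OF assms(1), of "b (frame Q x a)" 1 "vdiv r d * a"] assms(2)
    by (simp add: raise_def)
qed

text \<open>Only the values on SU(2) are constrained: the covariant derivative of a left-invariant field is
  left-invariant there, but has no meaning at other matrices.\<close>

definition left_field :: "real^3 \<Rightarrow> (cmat \<Rightarrow> cmat) \<Rightarrow> bool" where
  "left_field a V \<longleftrightarrow> (\<forall>x\<in>SU2. V x = frame Q x a)"

lemma left_fieldD: "left_field a V \<Longrightarrow> x \<in> SU2 \<Longrightarrow> V x = frame Q x a"
  by (simp add: left_field_def)

lemma left_field_left_ext:
  assumes "x \<in> SU2"
  shows "left_field a (left_ext x (frame Q x a))"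
  by (simp add: left_field_def left_ext_def frame_def SU2_cancel[OF assms])

lemma bracket_left_field:
  assumes "left_field a V" "left_field b W"
  shows "left_field (- cross3 a b) (bracket V W)"
proof -
  have "Q *v (- cross3 a b) = - cross3 (Q *v a) (Q *v b)"
    using cross_rotation_matrix[OF rotation, of a b]
    by (simp add: linear_neg[OF matrix_vector_mul_linear])
  then show ?thesis
    using assms
    by (simp add: left_field_def frame_def bracket_left_fields)
qed

lemma frame_tangent: "frame Q x a \<in> tangent x"
  by (simp add: tangent_frame)

lemma koszul_left_fields:
  assumes V: "left_field a V" and W: "left_field b W" and Z: "left_field c Z" and x: "x \<in> SU2"
  shows "koszul h V W Z x = 2 * ((d * connection d a b) \<bullet> c)"
proof -
  have const: "dd (\<lambda>y. h y (V' y) (W' y)) x (frame Q x u) = 0"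
    if "left_field a' V'" "left_field b' W'" for a' b' V' W' u
    by (rule dd_const[OF x frame_tangent]) (simp add: left_fieldD[OF that(1)] left_fieldD[OF that(2)] diag)
  show ?thesis
    by (simp add: koszul_def const[OF W Z] const[OF Z V] const[OF V W] left_fieldD[OF _ x] V W Z
        left_fieldD[OF V x] left_fieldD[OF W x] left_fieldD[OF Z x]
        left_fieldD[OF bracket_left_field[OF V W] x]
        left_fieldD[OF bracket_left_field[OF W Z] x]
        left_fieldD[OF bracket_left_field[OF Z V] x] diag[OF x] connection_koszul[OF pos]
        del: mult_minus_right)
qed

lemma nabla_left_field:
  assumes "left_field a V" "left_field b W"
  shows "left_field (connection d a b) (nabla h V W)"
  unfolding left_field_def nabla_def
  by (auto intro!: the_metric_dual koszul_left_fields assms left_field_left_ext)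

lemma riem_left_field:
  assumes U: "left_field a U" and V: "left_field b V" and W: "left_field c W" and x: "x \<in> SU2"
  shows "riem h U V W x = frame Q x (curvature d a b c)"
proof -
  have "riem h U V W x = frame Q x (connection d a (connection d b c))
      - frame Q x (connection d b (connection d a c))
      - frame Q x (connection d (- cross3 a b) c)"
    unfolding riem_def
    by (intro arg_cong2[of _ _ _ _ "(-)"] left_fieldD[OF _ x] nabla_left_field bracket_left_field assms)
  then show ?thesis
    by (simp add: curvature_def linear_diff[OF linear_frame] linear_add[OF linear_frame]
        linear_neg[OF linear_connection(2)] linear_neg[OF linear_frame])
qed

lemma Ric_diag:
  assumes x: "x \<in> SU2"
  shows "Ric h x (frame Q x a) (frame Q x b) = (ricci_diag d * a) \<bullet> b"
proof -
  define M where "M = matrix (\<lambda>c. curvature d c a b)"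
  have "riem h (left_ext x (frame Q x c)) (left_ext x (frame Q x a)) (left_ext x (frame Q x b)) x
      = frame Q x (M *v c)" for c
    by (simp add: riem_left_field[OF left_field_left_ext left_field_left_ext left_field_left_ext] x
        M_def matrix_works linear_curvature)
  then have "Ric h x (frame Q x a) (frame Q x b) = trace M"
    unfolding Ric_def by (rule endo_matrix_invariants(1)[OF orth x])
  also have "\<dots> = (ricci_diag d * a) \<bullet> b"
    by (simp add: ricci_trace[OF pos, symmetric] M_def matrix_def trace_def sum_3)
  finally show ?thesis .
qed

lemma scal_diag:
  assumes x: "x \<in> SU2"
  shows "scal h x = ricci_diag d $ 1 / d $ 1 + ricci_diag d $ 2 / d $ 2 + ricci_diag d $ 3 / d $ 3"
proof -
  have "raise h x (Ric h x) (frame Q x a) = frame Q x (diag_mat (vdiv (ricci_diag d) d) *v a)" for a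
    by (simp add: diag_mat_mult raise_diag[where b = "Ric h x", OF x Ric_diag[OF x]])
  from endo_matrix_invariants(1)[OF orth x this] show ?thesis
    by (simp add: scal_def trace_diag_mat vdiv_component)
qed

lemma einstein_diag:
  assumes x: "x \<in> SU2"
  shows "einstein_endo h x (frame Q x a) = frame Q x (- sect_vec d * a)"
proof -
  define s where "s = scal h x"
  have "einstein_endo h x (frame Q x a) = frame Q x (vdiv (ricci_diag d - (s / 2) *\<^sub>R d) d * a)"
    unfolding einstein_endo_def
    by (rule raise_diag[OF x])
      (simp add: Ric_diag[OF x] diag[OF x] inner_vec_def sum_3 s_def[symmetric] algebra_simps)
  moreover have "vdiv (ricci_diag d - (s / 2) *\<^sub>R d) d = - sect_vec d"
  proof -
    have "d $ k \<noteq> 0" for k using pos[of k] by simp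
    then show ?thesis
      by (simp add: vec_eq_iff vdiv_component diff_divide_distrib s_def scal_diag[OF x] einstein_eq_minus_sect[OF pos])
  qed
  ultimately show ?thesis by simp
qed

text \<open>Invertibility of the Einstein endomorphism forces all sectional curvatures to be nonzero, so that
  it can be inverted axis by axis.\<close>

lemma cross_curv_diag:
  assumes x: "x \<in> SU2" and "cross_defined h"
  shows "cross_curv h x (frame Q x a) (frame Q x b) = (cross_step d * a) \<bullet> b"
proof -
  let ?K = "sect_vec d"
  have bij: "bij_betw (einstein_endo h x) (tangent x) (tangent x)"
    using assms by (simp add: cross_defined_def)
  have K: "?K $ k \<noteq> 0" for k
  proof
    assume "?K $ k = 0"
    then have "- ?K * axis k 1 = - ?K * 0"
      by (simp add: vec_eq_iff axis_def)
    then have "einstein_endo h x (frame Q x (axis k 1)) = einstein_endo h x (frame Q x 0)"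
      by (simp only: einstein_diag[OF x])
    then have "frame Q x (axis k 1) = frame Q x 0"
      using bij frame_tangent by (auto simp: bij_betw_def dest: inj_onD)
    then show False
      by (simp add: frame_inj[OF x] axis_eq_0_iff)
  qed
  have "- ?K * (- vdiv a ?K) = a"
    using K by (simp add: vec_eq_iff vdiv_component)
  then have "einstein_endo h x (frame Q x (- vdiv a ?K)) = frame Q x a"
    by (simp only: einstein_diag[OF x])
  then have inv: "inv_into (tangent x) (einstein_endo h x) (frame Q x a) = frame Q x (- vdiv a ?K)"
    using bij frame_tangent by (metis bij_betw_def inv_into_f_f)
  have det: "det (endo_matrix x (einstein_endo h x)) = - (?K$1 * ?K$2 * ?K$3)"
    using endo_matrix_invariants(2)[OF orth x, of "einstein_endo h x" "diag_mat (- ?K)"]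
    by (simp add: diag_mat_mult einstein_diag[OF x] det_diag_mat)
  show ?thesis
    using K by (simp add: cross_curv_def inv det diag[OF x] inner_vec_def sum_3 vdiv_component
        cross_step_def field_simps)
qed

text \<open>The frame does not move under cross curvature, so the iteration takes place on the three diagonal
  coefficients.\<close>

lemma diagonal_metric_cross_curv:
  assumes "cross_defined h" "positive_definite (cross_curv h)"
  shows "diagonal_metric Q (cross_step d) (cross_curv h)"
proof
  show "rotation_matrix Q" by (rule rotation)
  show "cross_step d $ k > 0" for k
  proof -
    have "frame Q (mat 1) (axis k 1) \<noteq> 0"
      using frame_inj[OF one_in_SU2, of "axis k 1" 0]
      by (simp add: linear_0[OF linear_frame] axis_eq_0_iff)
    then have "cross_curv h (mat 1) (frame Q (mat 1) (axis k 1)) (frame Q (mat 1) (axis k 1)) > 0"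
      using assms(2) one_in_SU2 frame_tangent by (simp add: positive_definite_def)
    then show ?thesis
      by (simp add: cross_curv_diag[OF one_in_SU2 assms(1)] inner_axis)
  qed
qed (rule cross_curv_diag[OF _ assms(1)])

end

section \<open>Principal axes\<close>

text \<open>The variational step of the spectral theorem: at a maximum \<open>v\<close> of the quadratic form on the unit
  sphere of \<open>S\<close>, the first-order condition says that \<open>B v\<close> vanishes on the orthogonal complement of
  \<open>v\<close>.\<close>

lemma sphere_max_orthogonal:
  fixes B :: "'a::euclidean_space \<Rightarrow> 'a \<Rightarrow> real"
  assumes B: "bilinear B" and sym: "\<And>u v. B u v = B v u"
    and S: "subspace S" "S \<noteq> {0}"
  obtains v where "v \<in> S" "norm v = 1" "\<And>w. w \<in> S \<Longrightarrow> v \<bullet> w = 0 \<Longrightarrow> B v w = 0"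
proof -
  obtain s where "s \<in> S" "s \<noteq> 0"
    using S subspace_0 by blast
  then have "(1 / norm s) *\<^sub>R s \<in> sphere 0 1 \<inter> S"
    using S(1) by (simp add: subspace_scale)
  moreover have "compact (sphere 0 1 \<inter> S)"
    by (simp add: compact_Int_closed closed_subspace S)
  moreover have "continuous_on (sphere 0 1 \<inter> S) (\<lambda>u. B u u)"
    using B by (intro bounded_bilinear.continuous_on[of B] continuous_on_id)
      (simp add: bilinear_conv_bounded_bilinear)
  ultimately obtain v where v: "v \<in> S" "norm v = 1"
    and max: "\<And>u. u \<in> S \<Longrightarrow> norm u = 1 \<Longrightarrow> B u u \<le> B v v"
    using continuous_attains_sup[of "sphere 0 1 \<inter> S" "\<lambda>u. B u u"]
    by (metis IntD1 IntD2 IntI empty_iff mem_sphere_0)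
  have max': "B u u \<le> B v v * (u \<bullet> u)" if "u \<in> S" for u
  proof (cases "u = 0")
    case False
    have "B ((1 / norm u) *\<^sub>R u) ((1 / norm u) *\<^sub>R u) \<le> B v v"
      using that False by (intro max) (simp_all add: S subspace_scale)
    then show ?thesis
      using False by (simp add: bilinear_lmul[OF B] bilinear_rmul[OF B] field_simps
          flip: power2_norm_eq_inner power2_eq_square)
  qed (simp add: bilinear_lzero[OF B])
  have "B v w = 0" if w: "w \<in> S" "v \<bullet> w = 0" for w
  proof (rule ccontr)
    assume nz: "B v w \<noteq> 0"
    define K where "K = B v v * (w \<bullet> w) - B w w"
    \<comment> \<open>A step from \<open>v\<close> towards \<open>w\<close> so short that the linear gain \<open>2 t B v w\<close> beats the quadratic loss.\<close>
    define t where "t = B v w / (\<bar>K\<bar> + 1)"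
    have "v + t *\<^sub>R w \<in> S"
      using v w S by (simp add: subspace_add subspace_scale)
    moreover have "B (v + t *\<^sub>R w) (v + t *\<^sub>R w) = B v v + 2 * t * B v w + t\<^sup>2 * B w w"
      by (simp add: bilinear_ladd[OF B] bilinear_radd[OF B] bilinear_lmul[OF B]
          bilinear_rmul[OF B] sym[of w v] power2_eq_square algebra_simps)
    moreover have "(v + t *\<^sub>R w) \<bullet> (v + t *\<^sub>R w) = 1 + t\<^sup>2 * (w \<bullet> w)"
      using v(2) w(2) by (simp add: inner_add_left inner_add_right inner_commute[of w v]
          power2_eq_square norm_eq_1)
    ultimately have "2 * t * B v w \<le> t\<^sup>2 * K"
      using max'[of "v + t *\<^sub>R w"] by (simp add: K_def algebra_simps)
    moreover have "B v w = t * (\<bar>K\<bar> + 1)"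
      by (simp add: t_def)
    ultimately have "t\<^sup>2 * (2 * (\<bar>K\<bar> + 1)) \<le> t\<^sup>2 * K"
      by (simp add: power2_eq_square algebra_simps)
    moreover have "t \<noteq> 0"
      using nz by (simp add: t_def)
    ultimately have "2 * (\<bar>K\<bar> + 1) \<le> K"
      by (simp add: mult_le_cancel_left)
    then have "2 * \<bar>K\<bar> + 2 \<le> K" by simp
    then have "2 * \<bar>K\<bar> + 2 \<le> \<bar>K\<bar>" using abs_ge_self[of K] by (rule order_trans)
    then show False
      using abs_ge_zero[of K] by linarith
  qed
  then show thesis using that v by blast
qed

text \<open>A maximiser \<open>u\<close> on the sphere, a maximiser \<open>v\<close> on the circle orthogonal to \<open>u\<close>, and \<open>u \<times> v\<close> are
  principal axes. Taking the cross product as third vector makes the frame positively oriented.\<close>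

lemma rotation_diagonalises:
  fixes B :: "real^3 \<Rightarrow> real^3 \<Rightarrow> real"
  assumes B: "bilinear B" and sym: "\<And>u v. B u v = B v u"
  obtains Q d where "rotation_matrix Q" "\<And>a b. B (Q *v a) (Q *v b) = (d * a) \<bullet> b"
proof -
  have "(UNIV :: (real^3) set) \<noteq> {0}"
    by (metis UNIV_I axis_eq_0_iff singletonD zero_neq_one)
  then obtain u where u: "norm u = 1" "\<And>w. u \<bullet> w = 0 \<Longrightarrow> B u w = 0"
    using sphere_max_orthogonal[OF B sym subspace_UNIV] by auto
  define S where "S = {w. u \<bullet> w = 0}"
  have "S \<noteq> {0}"
  proof
    assume "S = {0}"
    then have "cross3 u w = 0" for w
      by (metis S_def dot_cross_self(1) mem_Collect_eq singletonD)
    then have "u = 0"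
      using u(1) cross_basis_nonzero by blast
    then show False using u(1) by simp
  qed
  moreover have "subspace S"
    by (simp add: S_def subspace_hyperplane)
  ultimately obtain v where v: "u \<bullet> v = 0" "norm v = 1"
    "\<And>w. u \<bullet> w = 0 \<Longrightarrow> v \<bullet> w = 0 \<Longrightarrow> B v w = 0"
    using sphere_max_orthogonal[OF B sym, of S] by (auto simp: S_def)
  define w where "w = cross3 u v"
  have uw: "u \<bullet> w = 0" "v \<bullet> w = 0" "w \<bullet> w = 1" "u \<bullet> u = 1" "v \<bullet> v = 1"
    using norm_cross_dot[of u v] u v
    by (simp_all add: w_def dot_cross_self norm_eq_1 flip: power2_norm_eq_inner)
  have B0: "B u v = 0" "B u w = 0" "B v w = 0"
    using u v uw by auto
  have B0': "B v u = 0" "B w u = 0" "B w v = 0"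
    by (simp_all only: B0 sym[of v u] sym[of w])
  define Q where "Q = transpose (vector [u, v, w] :: real^3^3)"
  have Qa: "Q *v a = a$1 *\<^sub>R u + a$2 *\<^sub>R v + a$3 *\<^sub>R w" for a
    by (simp add: Q_def vec_eq_iff matrix_vector_mult_def transpose_def sum_3 mult.commute)
  have "orthogonal_matrix Q"
    unfolding orthogonal_matrix Q_def transpose_transpose
    using uw v(1) by (simp add: vec_eq_iff forall_3 matrix_matrix_mult_def transpose_def mat_def
        inner_vec_def sum_3 mult.commute)
  moreover have "det Q = w \<bullet> (cross3 u v)"
    by (simp add: Q_def det_transpose) (simp add: cross3_simps)
  then have "det Q = 1"
    using uw by (simp add: w_def)
  ultimately have "rotation_matrix Q"
    by (simp add: rotation_matrix_def)
  moreover have "B (Q *v a) (Q *v b) = (vector [B u u, B v v, B w w] * a) \<bullet> b" for a b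
    by (simp add: Qa bilinear_ladd[OF B] bilinear_radd[OF B] bilinear_lmul[OF B] bilinear_rmul[OF B]
        B0 B0' inner_vec_def sum_3)
  ultimately show thesis by (rule that)
qed

text \<open>Left-invariance reduces the metric to its value at the identity, to which the principal axis
  theorem applies.\<close>

lemma left_invariant_metric_diagonal:
  assumes g: "riemannian_metric g" and inv: "left_invariant g"
  obtains Q d where "diagonal_metric Q d g"
proof -
  define B where "B a b = g (mat 1) (su2_of a) (su2_of b)" for a b
  have T: "su2_of a \<in> tangent (mat 1)" for a
    by (auto simp: tangent_def su2_eq_range)
  have add: "g (mat 1) (r *\<^sub>R u + s *\<^sub>R v) w = r * g (mat 1) u w + s * g (mat 1) v w"
    if "u \<in> tangent (mat 1)" "v \<in> tangent (mat 1)" "w \<in> tangent (mat 1)" for r s u v w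
    using g that one_in_SU2 unfolding riemannian_metric_def by blast
  have sym: "B a b = B b a" for a b
    using g T one_in_SU2 unfolding riemannian_metric_def B_def by blast
  have left: "linear (\<lambda>a. B a b)" for b
    using add[OF T T T, of 1 _ 1] add[OF T T T, of _ _ 0]
    by (simp add: linear_iff B_def linear_add[OF linear_su2_of] linear_cmul[OF linear_su2_of])
  then have "bilinear B"
    using sym by (simp add: bilinear_def)
  then obtain Q d where Q: "rotation_matrix Q"
    and d: "\<And>a b. B (Q *v a) (Q *v b) = (d * a) \<bullet> b"
    using rotation_diagonalises sym by metis
  have diag: "g x (frame Q x a) (frame Q x b) = (d * a) \<bullet> b" if x: "x \<in> SU2" for x a b
  proof -
    have "g (x ** mat 1) (x ** su2_of (Q *v a)) (x ** su2_of (Q *v b)) = B (Q *v a) (Q *v b)"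
      using inv x one_in_SU2 T unfolding left_invariant_def B_def by blast
    then show ?thesis by (simp add: frame_def d)
  qed
  have "d $ k > 0" for k
  proof -
    have "Q *v axis k 1 \<noteq> 0"
      using Q by (metis axis_eq_0_iff matrix_vector_mul_assoc matrix_vector_mul_lid
          matrix_vector_mult_0_right orthogonal_matrix_def rotation_matrix_def zero_neq_one)
    then have "su2_of (Q *v axis k 1) \<noteq> 0"
      using inj_su2_of linear_0[OF linear_su2_of] by metis
    then have "B (Q *v axis k 1) (Q *v axis k 1) > 0"
      using g T one_in_SU2 by (simp add: riemannian_metric_def positive_definite_def B_def)
    then show ?thesis by (simp add: d inner_axis)
  qed
  then show thesis
    using that Q diag by (metis diagonal_metric.intro)
qed

section \<open>Dynamics of cross curvature on diagonal metrics\<close>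

lemma sect_commute: "sect x z y = sect x y z"
  by (simp add: sect_def power2_commute[of z] add.commute mult.commute mult.left_commute)

text \<open>The shorter of two axes is orthogonal to the plane of larger curvature, as long as the triangle
  inequality \<open>z < x + y\<close> holds.\<close>

lemma sect_diff:
  assumes "x \<noteq> 0" "y \<noteq> 0" "z \<noteq> 0"
  shows "sect y z x - sect x y z = (x - y) * (x + y - z) / (x * y * z)"
  using assms by (simp add: sect_def divide_simps) algebra

text \<open>If \<open>x\<close> is at least \<open>y + z\<close>, the numerator of \<open>sect x y z\<close> is at most
  \<open>(y - z)\<^sup>2 - (y + z)\<^sup>2 < 0\<close>.\<close>

lemma sect_pos_triangle:
  assumes "x > 0" "y > 0" "z > 0" "sect x y z > 0"
  shows "x < y + z"
proof (rule ccontr)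
  assume "\<not> x < y + z"
  then have "x * (y + z) \<le> x\<^sup>2" "(y + z)\<^sup>2 \<le> x\<^sup>2"
    using assms by (simp_all add: power2_eq_square mult_left_mono mult_mono)
  moreover have "(y - z)\<^sup>2 < (y + z)\<^sup>2"
    using assms by (simp add: power2_eq_square algebra_simps)
  ultimately have "(y - z)\<^sup>2 + 2 * x * (y + z) - 3 * x\<^sup>2 < 0"
    by linarith
  then have "sect x y z < 0"
    using assms by (simp add: sect_def divide_neg_pos)
  then show False using assms(4) by simp
qed

lemma sect_pos_least:
  assumes "x > 0" "x \<le> y" "x \<le> z"
  shows "sect x y z > 0"
proof -
  have "x * (y + z) \<ge> x * (2 * x)"
    using assms by (intro mult_left_mono) auto
  then have "x * (y + z) \<ge> 2 * x\<^sup>2"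
    by (simp add: power2_eq_square)
  moreover have "x\<^sup>2 > 0" using assms by simp
  ultimately have "(y - z)\<^sup>2 + 2 * x * (y + z) - 3 * x\<^sup>2 > 0"
    using zero_le_power2[of "y - z"] by linarith
  then show ?thesis
    using assms by (simp add: sect_def)
qed

text \<open>The pairwise products of the curvatures are positive, so the curvatures share a sign; the shortest
  axis shows that the sign is positive.\<close>

lemma sect_vec_pos:
  assumes d: "\<And>k. d $ k > 0" and c: "\<And>k. cross_step d $ k > 0"
  shows "sect_vec d $ k > 0"
proof -
  have p: "0 < d$1" "0 < d$2" "0 < d$3" using d by auto
  have c3: "sect_vec d $ 2 * sect_vec d $ 3 > 0" "sect_vec d $ 3 * sect_vec d $ 1 > 0"
    "sect_vec d $ 1 * sect_vec d $ 2 > 0"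
    using c[of 1] c[of 2] c[of 3] p by (simp_all add: cross_step_def mult.assoc zero_less_mult_iff)
  have "sect_vec d $ 1 > 0 \<or> sect_vec d $ 2 > 0 \<or> sect_vec d $ 3 > 0"
    using sect_pos_least[OF p(1), of "d$2" "d$3"] sect_pos_least[OF p(2), of "d$3" "d$1"]
      sect_pos_least[OF p(3), of "d$1" "d$2"]
    by (simp add: sect_vec_def) linarith
  then have "sect_vec d $ 1 > 0 \<and> sect_vec d $ 2 > 0 \<and> sect_vec d $ 3 > 0"
    using c3 by (auto simp: zero_less_mult_iff)
  then show ?thesis using exhaust_3[of k] by auto
qed

text \<open>The factors \<open>sect z x y\<close> agree on both axes; what remains is \<open>sect x y z < sect y z x\<close>. The
  inequality \<open>z < x + y\<close> needed for that comes from the curvature \<open>sect z x y\<close>.\<close>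

lemma cross_step_ratio_axes:
  assumes x: "x > 0" "y > 0" "z > 0" and "y < x"
    and K: "sect x y z > 0" "sect y z x > 0" "sect z x y > 0"
  shows "(y * sect z x y * sect x y z) * x < (x * sect y z x * sect z x y) * y"
proof -
  have "x + y - z > 0"
    using sect_pos_triangle[OF x(3,1,2) K(3)] by simp
  then have "(x - y) * (x + y - z) / (x * y * z) > 0"
    using assms by simp
  then have "sect x y z < sect y z x"
    using sect_diff[of x y z] x by linarith
  then have "(x * y * sect z x y) * sect x y z < (x * y * sect z x y) * sect y z x"
    using x K(3) by simp
  then show ?thesis by (simp add: mult_ac)
qed

lemma cross_step_ratio:
  assumes d: "\<And>k. d $ k > 0" and c: "\<And>k. cross_step d $ k > 0" and "d $ k < d $ i"
  shows "cross_step d $ k * d $ i < cross_step d $ i * d $ k"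
proof -
  have p: "0 < d$1" "0 < d$2" "0 < d$3" using d by auto
  have K: "sect (d$1) (d$2) (d$3) > 0" "sect (d$2) (d$3) (d$1) > 0" "sect (d$3) (d$1) (d$2) > 0"
    using sect_vec_pos[OF d c, of 1] sect_vec_pos[OF d c, of 2] sect_vec_pos[OF d c, of 3]
    by (simp_all add: sect_vec_def)
  note step = cross_step_ratio_axes[of "d$1" "d$2" "d$3"] cross_step_ratio_axes[of "d$2" "d$3" "d$1"]
    cross_step_ratio_axes[of "d$3" "d$1" "d$2"] cross_step_ratio_axes[of "d$1" "d$3" "d$2"]
    cross_step_ratio_axes[of "d$2" "d$1" "d$3"] cross_step_ratio_axes[of "d$3" "d$2" "d$1"]
  show ?thesis
    using exhaust_3[of i] exhaust_3[of k] assms(3) p K step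
    by (auto simp: cross_step_def sect_vec_def sect_commute mult_ac)
qed

text \<open>The ratio of a larger to a smaller coefficient strictly increases with every step, so it cannot come back to
  its initial value. Ratios are compared in cross-multiplied form.\<close>

lemma cross_step_periodic_imp_constant:
  assumes pos: "\<And>j k. j \<le> n \<Longrightarrow> (cross_step ^^ j) d $ k > 0"
    and n: "n \<ge> 1" and per: "(cross_step ^^ n) d = d"
  shows "d $ i = d $ k"
proof -
  have False if less: "d $ k < d $ i" for i k
  proof -
    let ?e = "\<lambda>j. (cross_step ^^ j) d"
    have "?e j $ k * d $ i < ?e j $ i * d $ k" if "1 \<le> j" "j \<le> n" for j
      using that
    proof (induction j)
      case (Suc j)
      have p: "0 < ?e j $ l" "0 < cross_step (?e j) $ l" "0 < d $ l" for l
        using pos[of j l] pos[of "Suc j" l] pos[of 0 l] Suc.prems by auto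
      have le: "?e j $ k * d $ i \<le> ?e j $ i * d $ k"
        using Suc by (cases "j = 0") auto
      have "?e j $ k * d $ k < ?e j $ k * d $ i"
        using p less by simp
      then have "?e j $ k < ?e j $ i"
        using le p(3)[of k] by (meson less_le_trans mult_less_cancel_right_pos)
      from cross_step_ratio[OF p(1,2) this]
      have "cross_step (?e j) $ k * ?e j $ i * d $ k
          < cross_step (?e j) $ i * ?e j $ k * d $ k"
        using p(3) by simp
      moreover have "cross_step (?e j) $ k * (?e j $ k * d $ i) \<le> cross_step (?e j) $ k * (?e j $ i * d $ k)"
        by (rule mult_left_mono[OF le less_imp_le[OF p(2)]])
      ultimately have "(cross_step (?e j) $ k * d $ i) * ?e j $ k < (cross_step (?e j) $ i * d $ k) * ?e j $ k"
        by (simp add: mult_ac)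
      then show ?case
        using p(1)[of k] by simp
    qed simp
    from this[of n] show False
      using n by (simp add: per mult.commute)
  qed
  then show ?thesis by (meson linorder_neq_iff)
qed

theorem corollary8p2:
  fixes n :: nat and g :: tensor2
  assumes "n \<ge> 1"
    and "riemannian_metric g"
    and "left_invariant g"
    and "\<And>j. 1 \<le> j \<Longrightarrow> j \<le> n \<Longrightarrow>
           cross_defined ((cross_curv ^^ (j - 1)) g) \<and> positive_definite ((cross_curv ^^ j) g)"
    and "tensor_eq ((cross_curv ^^ n) g) g"
  shows "\<exists>\<rho>>0. tensor_eq g (\<lambda>x u v. \<rho> * g0 x u v)"
proof -
  obtain Q d where "diagonal_metric Q d g"
    using left_invariant_metric_diagonal assms(2,3) by blast
  then interpret g: diagonal_metric Q d g .
  have iter: "diagonal_metric Q ((cross_step ^^ j) d) ((cross_curv ^^ j) g)" if "j \<le> n" for j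
    using that
  proof (induction j)
    case 0
    show ?case by (simp add: g.diagonal_metric_axioms)
  next
    case (Suc j)
    then interpret gj: diagonal_metric Q "(cross_step ^^ j) d" "(cross_curv ^^ j) g" by simp
    show ?case
      using gj.diagonal_metric_cross_curv assms(4)[of "Suc j"] Suc.prems by simp
  qed
  have "(cross_step ^^ n) d $ k = d $ k" for k
  proof -
    have "(cross_curv ^^ n) g (mat 1) (frame Q (mat 1) (axis k 1)) (frame Q (mat 1) (axis k 1))
        = g (mat 1) (frame Q (mat 1) (axis k 1)) (frame Q (mat 1) (axis k 1))"
      using assms(5) one_in_SU2 g.frame_tangent by (simp add: tensor_eq_def)
    then show ?thesis
      by (simp add: g.diag[OF one_in_SU2] diagonal_metric.diag[OF iter[OF order_refl] one_in_SU2] inner_axis)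
  qed
  then have "(cross_step ^^ n) d = d" by (simp add: vec_eq_iff)
  then have const: "d $ k = d $ 1" for k
    using cross_step_periodic_imp_constant[of n d] assms(1) diagonal_metric.pos[OF iter] by blast
  have "g x u v = d $ 1 * g0 x u v" if x: "x \<in> SU2" and uv: "u \<in> tangent x" "v \<in> tangent x" for x u v
  proof -
    obtain a b where ab: "u = frame Q x a" "v = frame Q x b"
      using uv unfolding g.tangent_frame by blast
    have "transpose Q *v (Q *v a) = a"
      using g.orth by (simp add: matrix_vector_mul_assoc orthogonal_matrix_def
          del: transpose_matrix_vector)
    then have "(Q *v a) \<bullet> (Q *v b) = a \<bullet> b"
      by (simp flip: dot_lmul_matrix)
    then have "g0 x u v = a \<bullet> b"
      by (simp add: g0_def ab frame_def SU2_cancel[OF x] trace_su2_of)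
    moreover have "g x u v = d $ 1 * (a \<bullet> b)"
      by (simp add: ab g.diag[OF x] inner_vec_def sum_3 const[of 2] const[of 3] algebra_simps)
    ultimately show ?thesis by simp
  qed
  then show ?thesis
    using g.pos[of 1] by (auto simp: tensor_eq_def)
qed

end
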